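(* Let $\mathcal{Z}$ be a finite set with a distinguished element $0\in\mathcal{Z}$, $E=\prod_{z\in\mathcal{Z}}(L_z,U_z)$ a product of $|\mathcal{Z}|$ intervals of the real line, $c\in\mathbb{R}$, $\Lambda=\{q\in\mathbb{R}^{|\mathcal{Z}|}:\sum_{z\in\mathcal{Z}}q_z=c\}$, $q\in\Lambda$, and let $Q:E\to\Lambda$ be a continuous function satisfying: (a) weak substitutes; (b) the pivotal substitutes property around $q$; (c) for all $x\in\mathcal{Z}$, $Q$ is responsive to $x$ around $q_x$; (d) one can order $\mathcal{Z}=\{z_1=0,z_2,\dots,z_{|\mathcal{Z}|}\}$ so that for each $k\ge2$ there is a function $\bar Q_{z_k}$ on $E$ with $Q_{z_k}(p)\le\bar Q_{z_k}(p)$ for all $p\in E$, where $\bar Q_{z_k}(p)$ does not depend on $p_{z_{k+1}},\dots,p_{z_{|\mathcal{Z}|}}$ and is downward responsive around $q$ (i.e. $\lim_{p_{z_k}\to L_{z_k}}\bar Q_{z_k}(p)<q_{z_k}$, the other coordinates being fixed); (e) connected strict substitutes. Let $\psi:\mathbb{R}^{|\mathcal{Z}|}\to\mathbb{R}$ be a normalization mapping (with bounds $L_\psi,U_\psi$), and assume that $p_z<p_z'$ for all $z\in\mathcal{Z}$ implies $\psi(p)<\psi(p')$. Then, for any $K\in(L_\psi,U_\psi)$, the system $$Q(p)=q,\qquad\psi(p)=K$$ has a unique solution $p\in E$.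
   Context: The bounds satisfy $-\infty\le L_z<U_z\le+\infty$. Weak substitutes: for all $x\ne y$ in $\mathcal{Z}$, $Q_x(p)$ is nondecreasing in $p_x$ and nonincreasing in $p_y$. Pivotal substitutes around $q$: $Q$ has the downward (resp. upward) pivotal substitutes property around $q$ if for every nonempty proper subset $\mathcal{X}\subset\mathcal{Z}$ and every fixed value of $(p_x)_{x\in\mathcal{X}}$, the sum $\sum_{x\in\mathcal{X}}Q_x(p)$ becomes (i.e. eventually is) strictly smaller (resp. strictly larger) than $\sum_{x\in\mathcal{X}}q_x$ as every $p_z$, $z\notin\mathcal{X}$, tends to its upper bound $U_z$ (resp. to its lower bound $L_z$). It has the pivotal substitutes property around $q$ if it has both. Responsiveness: $Q$ is upward (resp. downward) responsive to $x$ around $q_x$ if, the other coordinates of $p$ being fixed arbitrarily, $\lim_{p_x\to U_x}Q_x(p)>q_x$ (resp. $\lim_{p_x\to L_x}Q_x(p)<q_x$). It is responsive if it is both. Connected strict substitutes: for every nonempty set $\mathcal{X}\subset\mathcal{Z}$ and all $p,p'\in E$, if $p_x=p'_x$ for $x\in\mathcal{X}$, $p_y\le p'_y$ for $y\notin\mathcal{X}$, and $p\ne p'$, then $\sum_{x\in\mathcal{X}}Q_x(p)>\sum_{x\in\mathcal{X}}Q_x(p')$. Normalization mapping: $\psi:\mathbb{R}^{|\mathcal{Z}|}\to\mathbb{R}$ (i) is continuous; (ii) is weakly increasing in $p_z$ for all $z\in\mathcal{Z}$; (iii) satisfies $\psi(p)\to L_\psi$ when $p_z\to L_z$ for all $z\in\mathcal{Z}$;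 (iv) satisfies $\psi(p)\to U_\psi$ when $p_z\to U_z$ for all $z\in\mathcal{Z}$; (v) satisfies $\psi(p+t1_{\mathcal{Z}})=\psi(p)+t$ for all $t\in\mathbb{R}$, where $1_{\mathcal{Z}}$ is the all-ones vector. $L_\psi,U_\psi$ may be infinite. *)

theory Defs
  imports "HOL-Analysis.Analysis"
begin

definition box_E :: "('z \<Rightarrow> ereal) \<Rightarrow> ('z \<Rightarrow> ereal) \<Rightarrow> (real ^ 'z::finite) set"
  where "box_E L U = {p. \<forall>z. L z < ereal (p $ z) \<and> ereal (p $ z) < U z}"

definition hyperplane_Lambda :: "real \<Rightarrow> (real ^ 'z::finite) set"
  where "hyperplane_Lambda c = {q. (\<Sum>z\<in>UNIV. q $ z) = c}"

text \<open>
  The filters below say that the coordinates in \<open>A\<close> tend jointly to their (possibly infinite)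
  bounds from inside the intervals, with no constraint on the remaining coordinates. These are
  pinned down by \<open>fixed_on\<close>: eventuality along \<open>inf (to_upper U A) (principal (fixed_on B p))\<close>
  with \<open>B = - A\<close> is the limit in the \<open>A\<close>-coordinates, the others being fixed as in \<open>p\<close>.
  If \<open>p \<in> box_E L U\<close> and \<open>L z < U z\<close> for all \<open>z\<close>, such points eventually lie in \<open>box_E L U\<close>.
\<close>

definition to_upper :: "('z \<Rightarrow> ereal) \<Rightarrow> 'z set \<Rightarrow> (real ^ 'z::finite) filter"
  where "to_upper U A = (INF z\<in>A. filtercomap (\<lambda>p. ereal (p $ z)) (at_left (U z)))"

definition to_lower :: "('z \<Rightarrow> ereal) \<Rightarrow> 'z set \<Rightarrow> (real ^ 'z::finite) filter"
  where "to_lower L A = (INF z\<in>A. filtercomap (\<lambda>p. ereal (p $ z)) (at_right (L z)))"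

definition fixed_on :: "'z set \<Rightarrow> real ^ 'z \<Rightarrow> (real ^ 'z::finite) set"
  where "fixed_on B p = {p'. \<forall>x\<in>B. p' $ x = p $ x}"

lemma eventually_box_E_to_upper:
  fixes p :: "real ^ 'z::finite"
  assumes "\<And>z. L z < U z" "p \<in> box_E L U"
  shows "eventually (\<lambda>p'. p' \<in> box_E L U) (inf (to_upper U A) (principal (fixed_on (- A) p)))"
proof -
  have "eventually (\<lambda>p'. L z < ereal (p' $ z) \<and> ereal (p' $ z) < U z)
          (inf (to_upper U A) (principal (fixed_on (- A) p)))" for z
  proof (cases "z \<in> A")
    case True
    have "eventually (\<lambda>t. L z < t \<and> t < U z) (at_left (U z))"
      using eventually_at_left[OF assms(1)[of z]] assms(1)[of z] by auto
    then have "eventually (\<lambda>p'. L z < ereal (p' $ z) \<and> ereal (p' $ z) < U z)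
        (filtercomap (\<lambda>p. ereal (p $ z)) (at_left (U z)))"
      by (rule eventually_filtercomapI)
    moreover have "inf (to_upper U A) (principal (fixed_on (- A) p))
        \<le> filtercomap (\<lambda>p. ereal (p $ z)) (at_left (U z))"
      unfolding to_upper_def by (rule le_infI1, rule INF_lower[OF True])
    ultimately show ?thesis by (rule filter_leD[rotated])
  next
    case False
    then show ?thesis
      using assms(2) by (auto simp: eventually_inf_principal fixed_on_def box_E_def)
  qed
  then show ?thesis
    unfolding box_E_def by (simp add: eventually_all_finite)
qed

lemma eventually_box_E_to_lower:
  fixes p :: "real ^ 'z::finite"
  assumes "\<And>z. L z < U z" "p \<in> box_E L U"
  shows "eventually (\<lambda>p'. p' \<in> box_E L U) (inf (to_lower L A) (principal (fixed_on (- A) p)))"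
proof -
  have "eventually (\<lambda>p'. L z < ereal (p' $ z) \<and> ereal (p' $ z) < U z)
          (inf (to_lower L A) (principal (fixed_on (- A) p)))" for z
  proof (cases "z \<in> A")
    case True
    have "eventually (\<lambda>t. L z < t \<and> t < U z) (at_right (L z))"
      using eventually_at_right[OF assms(1)[of z]] assms(1)[of z] by auto
    then have "eventually (\<lambda>p'. L z < ereal (p' $ z) \<and> ereal (p' $ z) < U z)
        (filtercomap (\<lambda>p. ereal (p $ z)) (at_right (L z)))"
      by (rule eventually_filtercomapI)
    moreover have "inf (to_lower L A) (principal (fixed_on (- A) p))
        \<le> filtercomap (\<lambda>p. ereal (p $ z)) (at_right (L z))"
      unfolding to_lower_def by (rule le_infI1, rule INF_lower[OF True])
    ultimately show ?thesis by (rule filter_leD[rotated])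
  next
    case False
    then show ?thesis
      using assms(2) by (auto simp: eventually_inf_principal fixed_on_def box_E_def)
  qed
  then show ?thesis
    unfolding box_E_def by (simp add: eventually_all_finite)
qed

definition weak_substitutes ::
    "('z \<Rightarrow> ereal) \<Rightarrow> ('z \<Rightarrow> ereal) \<Rightarrow> (real ^ 'z \<Rightarrow> real ^ 'z::finite) \<Rightarrow> bool"
  where "weak_substitutes L U Q \<longleftrightarrow>
    (\<forall>x. \<forall>p\<in>box_E L U. \<forall>p'\<in>box_E L U.
       p' \<in> fixed_on (- {x}) p \<longrightarrow> p $ x \<le> p' $ x \<longrightarrow> Q p $ x \<le> Q p' $ x) \<and>
    (\<forall>x y. x \<noteq> y \<longrightarrow> (\<forall>p\<in>box_E L U. \<forall>p'\<in>box_E L U.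
       p' \<in> fixed_on (- {y}) p \<longrightarrow> p $ y \<le> p' $ y \<longrightarrow> Q p' $ x \<le> Q p $ x))"

definition downward_pivotal_substitutes ::
    "('z \<Rightarrow> ereal) \<Rightarrow> ('z \<Rightarrow> ereal) \<Rightarrow> (real ^ 'z \<Rightarrow> real ^ 'z) \<Rightarrow> real ^ 'z::finite \<Rightarrow> bool"
  where "downward_pivotal_substitutes L U Q q \<longleftrightarrow>
    (\<forall>X. X \<noteq> {} \<longrightarrow> X \<subset> UNIV \<longrightarrow> (\<forall>p\<in>box_E L U.
       eventually (\<lambda>p'. (\<Sum>x\<in>X. Q p' $ x) < (\<Sum>x\<in>X. q $ x))
         (inf (to_upper U (- X)) (principal (fixed_on X p)))))"

definition upward_pivotal_substitutes ::
    "('z \<Rightarrow> ereal) \<Rightarrow> ('z \<Rightarrow> ereal) \<Rightarrow> (real ^ 'z \<Rightarrow> real ^ 'z) \<Rightarrow> real ^ 'z::finite \<Rightarrow> bool"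
  where "upward_pivotal_substitutes L U Q q \<longleftrightarrow>
    (\<forall>X. X \<noteq> {} \<longrightarrow> X \<subset> UNIV \<longrightarrow> (\<forall>p\<in>box_E L U.
       eventually (\<lambda>p'. (\<Sum>x\<in>X. Q p' $ x) > (\<Sum>x\<in>X. q $ x))
         (inf (to_lower L (- X)) (principal (fixed_on X p)))))"

definition pivotal_substitutes ::
    "('z \<Rightarrow> ereal) \<Rightarrow> ('z \<Rightarrow> ereal) \<Rightarrow> (real ^ 'z \<Rightarrow> real ^ 'z) \<Rightarrow> real ^ 'z::finite \<Rightarrow> bool"
  where "pivotal_substitutes L U Q q \<longleftrightarrow>
    downward_pivotal_substitutes L U Q q \<and> upward_pivotal_substitutes L U Q q"

text \<open>
  Responsiveness is stated for a scalar function \<open>f\<close> (a component of \<open>Q\<close>, or an upper bound for one)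
  and a target value \<open>a\<close>. The limit has to exist, but only in the extended reals.
\<close>

definition upward_responsive ::
    "('z \<Rightarrow> ereal) \<Rightarrow> ('z \<Rightarrow> ereal) \<Rightarrow> (real ^ 'z::finite \<Rightarrow> real) \<Rightarrow> 'z \<Rightarrow> real \<Rightarrow> bool"
  where "upward_responsive L U f x a \<longleftrightarrow>
    (\<forall>p\<in>box_E L U. \<exists>l. l > ereal a \<and>
       ((\<lambda>p'. ereal (f p')) \<longlongrightarrow> l) (inf (to_upper U {x}) (principal (fixed_on (- {x}) p))))"

definition downward_responsive ::
    "('z \<Rightarrow> ereal) \<Rightarrow> ('z \<Rightarrow> ereal) \<Rightarrow> (real ^ 'z::finite \<Rightarrow> real) \<Rightarrow> 'z \<Rightarrow> real \<Rightarrow> bool"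
  where "downward_responsive L U f x a \<longleftrightarrow>
    (\<forall>p\<in>box_E L U. \<exists>l. l < ereal a \<and>
       ((\<lambda>p'. ereal (f p')) \<longlongrightarrow> l) (inf (to_lower L {x}) (principal (fixed_on (- {x}) p))))"

definition responsive ::
    "('z \<Rightarrow> ereal) \<Rightarrow> ('z \<Rightarrow> ereal) \<Rightarrow> (real ^ 'z::finite \<Rightarrow> real) \<Rightarrow> 'z \<Rightarrow> real \<Rightarrow> bool"
  where "responsive L U f x a \<longleftrightarrow> upward_responsive L U f x a \<and> downward_responsive L U f x a"

definition connected_strict_substitutes ::
    "('z \<Rightarrow> ereal) \<Rightarrow> ('z \<Rightarrow> ereal) \<Rightarrow> (real ^ 'z \<Rightarrow> real ^ 'z::finite) \<Rightarrow> bool"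
  where "connected_strict_substitutes L U Q \<longleftrightarrow>
    (\<forall>X. X \<noteq> {} \<longrightarrow> (\<forall>p\<in>box_E L U. \<forall>p'\<in>box_E L U.
       (\<forall>x\<in>X. p $ x = p' $ x) \<longrightarrow> (\<forall>y. y \<notin> X \<longrightarrow> p $ y \<le> p' $ y) \<longrightarrow> p \<noteq> p' \<longrightarrow>
       (\<Sum>x\<in>X. Q p $ x) > (\<Sum>x\<in>X. Q p' $ x)))"

definition normalization_mapping ::
    "('z \<Rightarrow> ereal) \<Rightarrow> ('z \<Rightarrow> ereal) \<Rightarrow> ereal \<Rightarrow> ereal \<Rightarrow> (real ^ 'z::finite \<Rightarrow> real) \<Rightarrow> bool"
  where "normalization_mapping L U L\<psi> U\<psi> \<psi> \<longleftrightarrow>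
    continuous_on UNIV \<psi> \<and>
    (\<forall>z p p'. p' \<in> fixed_on (- {z}) p \<longrightarrow> p $ z \<le> p' $ z \<longrightarrow> \<psi> p \<le> \<psi> p') \<and>
    ((\<lambda>p. ereal (\<psi> p)) \<longlongrightarrow> L\<psi>) (to_lower L UNIV) \<and>
    ((\<lambda>p. ereal (\<psi> p)) \<longlongrightarrow> U\<psi>) (to_upper U UNIV) \<and>
    (\<forall>p t. \<psi> (p + t *\<^sub>R 1) = \<psi> p + t)"

end

theory Submission
  imports Defs
begin

text \<open>
  Fix the coordinate \<open>z0\<close>. The points with \<open>Q p $ z \<le> q $ z\<close> for all \<open>z \<noteq> z0\<close> are closed under
  joins; there are some because the coordinates can be lowered successively in the given order,
  and by downward pivotal substitutes their supremum stays inside the box. At the supremum no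
  coordinate can be raised any further, so it solves \<open>Q p = q\<close>. Connected strict substitutes make
  any two distinct solutions comparable strictly in every coordinate, so the solutions form a curve
  parametrized by the coordinate \<open>z0\<close>. Pivotal substitutes force all coordinates to their bounds
  along this curve, hence \<open>\<psi>\<close>, strictly increasing on it, takes the value \<open>K\<close> exactly once.
\<close>

section \<open>Limits at the bounds expressed by thresholds\<close>

text \<open>The index set is finite, so an eventual property is witnessed by one eventual property
  per coordinate of \<open>A\<close>, and each of these holds on a left neighbourhood of the
  bound.\<close>

lemma eventually_to_upperE:
  fixes B :: "(real ^ 'z::finite) set" and L U :: "'z \<Rightarrow> ereal"
  assumes "\<And>z. L z < U z" "eventually P (inf (to_upper U A) (principal B))"
  obtains t where "\<And>z. t z < U z"
    "\<And>p. p \<in> B \<Longrightarrow> (\<And>z. z \<in> A \<Longrightarrow> t z < ereal (p $ z) \<and> ereal (p $ z) < U z) \<Longrightarrow> P p"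
proof -
  from assms(2) obtain R where
    R: "\<And>z. z \<in> A \<Longrightarrow> eventually (R z) (filtercomap (\<lambda>p. ereal (p $ z)) (at_left (U z)))"
    and RP: "\<And>p. (\<And>z. z \<in> A \<Longrightarrow> R z p) \<Longrightarrow> p \<in> B \<Longrightarrow> P p"
    unfolding to_upper_def eventually_inf_principal eventually_INF_finite[OF finite] by metis
  \<comment> \<open>The implication makes the threshold total in \<open>z\<close>: outside
    \<open>A\<close> any value below \<open>U z\<close> will do.\<close>
  have "\<exists>t<U z. z \<in> A \<longrightarrow> (\<forall>p. t < ereal (p $ z) \<and> ereal (p $ z) < U z \<longrightarrow> R z p)" for z
  proof (cases "z \<in> A")
    case True
    from R[OF True] obtain R' where R': "eventually R' (at_left (U z))"
      and "\<And>p. R' (ereal (p $ z)) \<Longrightarrow> R z p"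
      unfolding eventually_filtercomap by metis
    moreover from R' obtain t where "t < U z" "\<And>y. t < y \<Longrightarrow> y < U z \<Longrightarrow> R' y"
      unfolding eventually_at_left[OF assms(1)[of z]] by metis
    ultimately show ?thesis by blast
  qed (use assms(1) in auto)
  then obtain t where "\<And>z. t z < U z"
    "\<And>z p. z \<in> A \<Longrightarrow> t z < ereal (p $ z) \<and> ereal (p $ z) < U z \<Longrightarrow> R z p"
    by metis
  then show thesis
    using that[of t] RP by blast
qed

lemma eventually_to_lowerE:
  fixes B :: "(real ^ 'z::finite) set" and L U :: "'z \<Rightarrow> ereal"
  assumes "\<And>z. L z < U z" "eventually P (inf (to_lower L A) (principal B))"
  obtains t where "\<And>z. L z < t z"
    "\<And>p. p \<in> B \<Longrightarrow> (\<And>z. z \<in> A \<Longrightarrow> L z < ereal (p $ z) \<and> ereal (p $ z) < t z) \<Longrightarrow> P p"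
proof -
  from assms(2) obtain R where
    R: "\<And>z. z \<in> A \<Longrightarrow> eventually (R z) (filtercomap (\<lambda>p. ereal (p $ z)) (at_right (L z)))"
    and RP: "\<And>p. (\<And>z. z \<in> A \<Longrightarrow> R z p) \<Longrightarrow> p \<in> B \<Longrightarrow> P p"
    unfolding to_lower_def eventually_inf_principal eventually_INF_finite[OF finite] by metis
  have "\<exists>t>L z. z \<in> A \<longrightarrow> (\<forall>p. L z < ereal (p $ z) \<and> ereal (p $ z) < t \<longrightarrow> R z p)" for z
  proof (cases "z \<in> A")
    case True
    from R[OF True] obtain R' where R': "eventually R' (at_right (L z))"
      and "\<And>p. R' (ereal (p $ z)) \<Longrightarrow> R z p"
      unfolding eventually_filtercomap by metis
    moreover from R' obtain t where "L z < t" "\<And>y. L z < y \<Longrightarrow> y < t \<Longrightarrow> R' y"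
      unfolding eventually_at_right[OF assms(1)[of z]] by metis
    ultimately show ?thesis by blast
  qed (use assms(1) in auto)
  then obtain t where "\<And>z. L z < t z"
    "\<And>z p. z \<in> A \<Longrightarrow> L z < ereal (p $ z) \<and> ereal (p $ z) < t z \<Longrightarrow> R z p"
    by metis
  then show thesis
    using that[of t] RP by blast
qed

section \<open>Order and topology of the box\<close>

lemma box_E_order_convex:
  assumes "a \<in> box_E L U" "b \<in> box_E L U" "a \<le> p" "p \<le> b"
  shows "p \<in> box_E L U"
  using assms unfolding box_E_def less_eq_vec_def
  by (auto intro: less_le_trans le_less_trans simp flip: ereal_less_eq(3))

lemma sup_in_box_E: "p \<in> box_E L U \<Longrightarrow> p' \<in> box_E L U \<Longrightarrow> sup p p' \<in> box_E L U"
  by (auto simp: box_E_def sup_vec_def sup_real_def max_def)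

lemma open_box_E: "open (box_E L U)"
proof -
  have "box_E L U = (\<Inter>z. {p. L z < ereal (p $ z)} \<inter> {p. ereal (p $ z) < U z})"
    by (auto simp: box_E_def)
  also have "open \<dots>"
    by (intro open_INT open_Int open_Collect_less continuous_intros finite_UNIV ballI) auto
  finally show ?thesis .
qed

lemma box_E_nonempty:
  fixes L U :: "'z::finite \<Rightarrow> ereal"
  assumes "\<And>z. L z < U z"
  shows "box_E L U \<noteq> {}"
proof -
  obtain r where "\<And>z. L z < ereal (r z) \<and> ereal (r z) < U z"
    using ereal_dense2[OF assms] by metis
  then have "(\<chi> z. r z) \<in> box_E L U" by (simp add: box_E_def)
  then show ?thesis by auto
qed

section \<open>Pivotal inequalities on families closed under joins or meets\<close>

text \<open>A join keeps every coordinate that has already passed its threshold, so witnesses for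
  single coordinates can be merged by induction on \<open>A\<close>. Nonemptiness of
  \<open>S\<close> settles the case of empty \<open>A\<close>.\<close>

lemma ex_common_upper:
  fixes S :: "(real ^ 'z::finite) set" and t :: "'z \<Rightarrow> ereal"
  assumes "S \<noteq> {}" "\<And>p p'. p \<in> S \<Longrightarrow> p' \<in> S \<Longrightarrow> sup p p' \<in> S"
    and "\<And>z. z \<in> A \<Longrightarrow> \<exists>p\<in>S. t z < ereal (p $ z)"
  shows "\<exists>p\<in>S. \<forall>z\<in>A. t z < ereal (p $ z)"
proof -
  have "finite A" by simp
  then show ?thesis using assms(3)
  proof (induction A)
    case (insert x A)
    obtain p where "p \<in> S" "\<forall>z\<in>A. t z < ereal (p $ z)"
      using insert.IH[OF insert.prems[OF insertI2]] by blast
    moreover obtain p' where "p' \<in> S" "t x < ereal (p' $ x)"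
      using insert.prems[of x] by blast
    ultimately show ?case
      by (intro bexI[of _ "sup p p'"] assms(2))
        (auto simp: sup_vec_def sup_real_def less_max_iff_disj)
  qed (use assms(1) in auto)
qed

lemma ex_common_lower:
  fixes S :: "(real ^ 'z::finite) set" and t :: "'z \<Rightarrow> ereal"
  assumes "S \<noteq> {}" "\<And>p p'. p \<in> S \<Longrightarrow> p' \<in> S \<Longrightarrow> inf p p' \<in> S"
    and "\<And>z. z \<in> A \<Longrightarrow> \<exists>p\<in>S. ereal (p $ z) < t z"
  shows "\<exists>p\<in>S. \<forall>z\<in>A. ereal (p $ z) < t z"
proof -
  have "finite A" by simp
  then show ?thesis using assms(3)
  proof (induction A)
    case (insert x A)
    obtain p where "p \<in> S" "\<forall>z\<in>A. ereal (p $ z) < t z"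
      using insert.IH[OF insert.prems[OF insertI2]] by blast
    moreover obtain p' where "p' \<in> S" "ereal (p' $ x) < t x"
      using insert.prems[of x] by blast
    ultimately show ?case
      by (intro bexI[of _ "inf p p'"] assms(2))
        (auto simp: inf_vec_def inf_real_def min_less_iff_disj)
  qed (use assms(1) in auto)
qed

text \<open>Outside \<open>X\<close> the members of \<open>S\<close> come arbitrarily close to the
  upper bounds, so some member passes all thresholds there. Raising its \<open>X\<close>-coordinates
  to the suprema yields a point to which \<open>pivot\<close> applies, and \<open>mono\<close>
  carries the inequality back. In the applications \<open>F\<close> sums \<open>Q\<close> over
  \<open>X\<close>; an abstract \<open>F\<close> lets the dual follow by negation.\<close>

lemma pivotal_sup:
  fixes S :: "(real ^ 'z::finite) set" and L U :: "'z \<Rightarrow> ereal" and F :: "real ^ 'z \<Rightarrow> real"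
  assumes S: "S \<subseteq> box_E L U" "S \<noteq> {}" "\<And>p p'. p \<in> S \<Longrightarrow> p' \<in> S \<Longrightarrow> sup p p' \<in> S"
    and X: "X = {z. (SUP p\<in>S. ereal (p $ z)) < U z}"
    and mono: "\<And>p p'. p \<in> box_E L U \<Longrightarrow> p' \<in> box_E L U \<Longrightarrow> p \<le> p' \<Longrightarrow>
      (\<And>z. z \<notin> X \<Longrightarrow> p $ z = p' $ z) \<Longrightarrow> F p \<le> F p'"
    and pivot: "\<And>p. p \<in> box_E L U \<Longrightarrow> \<exists>t. (\<forall>z. t z < U z) \<and>
      (\<forall>p'\<in>box_E L U. (\<forall>z\<in>X. p' $ z = p $ z) \<longrightarrow> (\<forall>z\<in>-X. t z < ereal (p' $ z)) \<longrightarrow> F p' < a)"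
  shows "\<exists>p\<in>S. F p < a"
proof -
  obtain p0 where p0: "p0 \<in> S" using S(2) by auto
  \<comment> \<open>Outside \<open>X\<close> the supremum may be infinite or lie on the boundary.
    The coordinates of \<open>p0\<close> only fill the gap, since \<open>pivot\<close> looks at
    \<open>s\<close> on \<open>X\<close> alone.\<close>
  define s where "s = (\<chi> z. if z \<in> X then real_of_ereal (SUP p\<in>S. ereal (p $ z)) else p0 $ z)"
  have upper: "ereal (p $ z) \<le> (SUP p\<in>S. ereal (p $ z))" if "p \<in> S" for p z
    by (rule SUP_upper[OF that])
  have sX: "ereal (s $ z) = (SUP p\<in>S. ereal (p $ z))" if "z \<in> X" for z
    using upper[OF p0, of z] that
    by (cases "SUP p\<in>S. ereal (p $ z)") (auto simp: s_def X)
  have s: "s \<in> box_E L U"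
  proof -
    have "L z < ereal (s $ z) \<and> ereal (s $ z) < U z" for z
    proof (cases "z \<in> X")
      case True
      have "L z < ereal (p0 $ z)" using p0 S(1) by (auto simp: box_E_def)
      then show ?thesis
        using sX[OF True] upper[OF p0, of z] True X by (auto intro: less_le_trans)
    next
      case False
      then show ?thesis using p0 S(1) by (auto simp: box_E_def s_def)
    qed
    then show ?thesis by (simp add: box_E_def)
  qed
  from pivot[OF s] obtain t where t: "\<And>z. t z < U z"
    "\<And>p'. p' \<in> box_E L U \<Longrightarrow> (\<And>z. z \<in> X \<Longrightarrow> p' $ z = s $ z) \<Longrightarrow>
      (\<And>z. z \<notin> X \<Longrightarrow> t z < ereal (p' $ z)) \<Longrightarrow> F p' < a"
    by (metis ComplD)
  have "\<exists>p\<in>S. t z < ereal (p $ z)" if "z \<in> - X" for z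
    using that t(1)[of z] by (auto simp: X less_SUP_iff not_less dest: less_le_trans)
  then obtain p where p: "p \<in> S" "\<And>z. z \<notin> X \<Longrightarrow> t z < ereal (p $ z)"
    using ex_common_upper[OF S(2,3), of "-X" t] by auto
  define p' where "p' = (\<chi> z. if z \<in> X then s $ z else p $ z)"
  have "p' \<in> box_E L U"
    using s p(1) S(1) by (auto simp: p'_def box_E_def)
  moreover have "p \<le> p'"
    using upper[OF p(1)] sX by (auto simp: p'_def less_eq_vec_def simp flip: ereal_less_eq(3))
  ultimately have "F p \<le> F p'" "F p' < a"
    using p S(1) by (auto intro!: mono t(2) simp: p'_def)
  then show ?thesis using p(1) by (meson le_less_trans)
qed

text \<open>Negating vectors exchanges the bounds as well as joins and meets, and
  \<open>- F (- p)\<close> is again monotone in the \<open>X\<close>-coordinates, so this is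
  \<open>pivotal_sup\<close> for the reflected data.\<close>

lemma pivotal_inf:
  fixes S :: "(real ^ 'z::finite) set" and L U :: "'z \<Rightarrow> ereal" and F :: "real ^ 'z \<Rightarrow> real"
  assumes S: "S \<subseteq> box_E L U" "S \<noteq> {}" "\<And>p p'. p \<in> S \<Longrightarrow> p' \<in> S \<Longrightarrow> inf p p' \<in> S"
    and X: "X = {z. L z < (INF p\<in>S. ereal (p $ z))}"
    and mono: "\<And>p p'. p \<in> box_E L U \<Longrightarrow> p' \<in> box_E L U \<Longrightarrow> p \<le> p' \<Longrightarrow>
      (\<And>z. z \<notin> X \<Longrightarrow> p $ z = p' $ z) \<Longrightarrow> F p \<le> F p'"
    and pivot: "\<And>p. p \<in> box_E L U \<Longrightarrow> \<exists>t. (\<forall>z. L z < t z) \<and>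
      (\<forall>p'\<in>box_E L U. (\<forall>z\<in>X. p' $ z = p $ z) \<longrightarrow> (\<forall>z\<in>-X. ereal (p' $ z) < t z) \<longrightarrow> a < F p')"
  shows "\<exists>p\<in>S. a < F p"
proof -
  let ?L = "\<lambda>z. - U z" and ?U = "\<lambda>z. - L z" and ?F = "\<lambda>p. - F (- p)"
  have E: "p \<in> box_E ?L ?U \<longleftrightarrow> - p \<in> box_E L U" for p
    by (auto simp: box_E_def ereal_uminus_less_reorder ereal_less_uminus_reorder
        simp flip: uminus_ereal.simps(1))
  have "\<exists>p\<in>uminus ` S. ?F p < - a"
  proof (rule pivotal_sup)
    show "uminus ` S \<subseteq> box_E ?L ?U" "uminus ` S \<noteq> {}"
      using S(1,2) by (auto simp: E)
    show "sup p p' \<in> uminus ` S" if "p \<in> uminus ` S" "p' \<in> uminus ` S" for p p'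
    proof -
      have "sup p p' = - inf (- p) (- p')"
        by (simp add: sup_vec_def inf_vec_def vec_eq_iff inf_real_def sup_real_def minus_min_eq_max)
      then show ?thesis using that S(3) by auto
    qed
    have "(SUP p\<in>uminus ` S. ereal (p $ z)) = - (INF p\<in>S. ereal (p $ z))" for z
      using ereal_SUP_uminus_eq[of "\<lambda>p. ereal (p $ z)" S] by (simp add: image_image)
    then show "X = {z. (SUP p\<in>uminus ` S. ereal (p $ z)) < ?U z}"
      by (simp add: X)
    show "?F p \<le> ?F p'" if "p \<in> box_E ?L ?U" "p' \<in> box_E ?L ?U" "p \<le> p'"
      "\<And>z. z \<notin> X \<Longrightarrow> p $ z = p' $ z" for p p'
      using that mono[of "- p'" "- p"] by (auto simp: E less_eq_vec_def)
    show "\<exists>t. (\<forall>z. t z < ?U z) \<and> (\<forall>p'\<in>box_E ?L ?U. (\<forall>z\<in>X. p' $ z = p $ z) \<longrightarrow>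
        (\<forall>z\<in>-X. t z < ereal (p' $ z)) \<longrightarrow> ?F p' < - a)" if p: "p \<in> box_E ?L ?U" for p
    proof -
      from pivot[of "- p"] p obtain t where t: "\<And>z. L z < t z"
        "\<And>p'. p' \<in> box_E L U \<Longrightarrow> (\<And>z. z \<in> X \<Longrightarrow> p' $ z = - p $ z) \<Longrightarrow>
          (\<And>z. z \<in> - X \<Longrightarrow> ereal (p' $ z) < t z) \<Longrightarrow> a < F p'"
        by (metis E vector_uminus_component)
      have "?F p' < - a" if "p' \<in> box_E ?L ?U" "\<forall>z\<in>X. p' $ z = p $ z"
        "\<forall>z\<in>-X. - t z < ereal (p' $ z)" for p'
        using that t(2)[of "- p'"]
        by (auto simp: E ereal_uminus_less_reorder simp flip: uminus_ereal.simps(1))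
      with t(1) show ?thesis
        by (intro exI[of _ "\<lambda>z. - t z"]) auto
    qed
  qed
  then show ?thesis by auto
qed

section \<open>Consequences of connected strict substitutes\<close>

text \<open>The weak form also admits the empty set and equal points, where the two sums
  coincide.\<close>

lemma css_sum_antimono:
  assumes "connected_strict_substitutes L U Q" "p \<in> box_E L U" "p' \<in> box_E L U" "p \<le> p'"
    and "\<And>x. x \<in> X \<Longrightarrow> p $ x = p' $ x"
  shows "(\<Sum>x\<in>X. Q p' $ x) \<le> (\<Sum>x\<in>X. Q p $ x)"
proof (cases "X = {} \<or> p = p'")
  case False
  then have "(\<Sum>x\<in>X. Q p' $ x) < (\<Sum>x\<in>X. Q p $ x)"
    using assms unfolding connected_strict_substitutes_def less_eq_vec_def by blast
  then show ?thesis by simp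
qed auto

lemma sum_add_sum_Compl:
  fixes v :: "real ^ 'z::finite"
  assumes "v \<in> hyperplane_Lambda c"
  shows "(\<Sum>x\<in>X. v $ x) + (\<Sum>x\<in>-X. v $ x) = c"
  using assms sum.union_disjoint[of X "- X" "\<lambda>x. v $ x"] by (simp add: hyperplane_Lambda_def)

text \<open>The sum over the complement cannot rise and the total is always \<open>c\<close>. This
  supplies the hypothesis \<open>mono\<close> of \<open>pivotal_sup\<close> and
  \<open>pivotal_inf\<close>.\<close>

lemma css_sum_mono:
  fixes Q :: "real ^ 'z::finite \<Rightarrow> real ^ 'z"
  assumes css: "connected_strict_substitutes L U Q" and Q: "Q \<in> box_E L U \<rightarrow> hyperplane_Lambda c"
    and p: "p \<in> box_E L U" "p' \<in> box_E L U" "p \<le> p'" "\<And>x. x \<notin> X \<Longrightarrow> p $ x = p' $ x"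
  shows "(\<Sum>x\<in>X. Q p $ x) \<le> (\<Sum>x\<in>X. Q p' $ x)"
proof -
  have "(\<Sum>x\<in>-X. Q p' $ x) \<le> (\<Sum>x\<in>-X. Q p $ x)"
    using css_sum_antimono[OF css p(1-3), of "-X"] p(4) by simp
  moreover have "Q p \<in> hyperplane_Lambda c" "Q p' \<in> hyperplane_Lambda c"
    using Q p by auto
  note this[THEN sum_add_sum_Compl, of X]
  ultimately show ?thesis by linarith
qed

text \<open>Two incomparable solutions are compared with their meet \<open>m\<close>, which agrees
  with \<open>p\<close> on \<open>A\<close> and with \<open>p'\<close> elsewhere. Passing to
  \<open>m\<close> strictly raises the sum over \<open>A\<close> and does not lower the one over
  \<open>- A\<close>, so the total at \<open>m\<close> would exceed \<open>c\<close>.\<close>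

lemma css_le_or_le:
  fixes Q :: "real ^ 'z::finite \<Rightarrow> real ^ 'z"
  assumes css: "connected_strict_substitutes L U Q" and Q: "Q \<in> box_E L U \<rightarrow> hyperplane_Lambda c"
    and p: "p \<in> box_E L U" and p': "p' \<in> box_E L U" and eq: "Q p = Q p'"
  shows "p \<le> p' \<or> p' \<le> p"
proof (rule ccontr)
  assume neg: "\<not> ?thesis"
  define A where "A = {z. p $ z \<le> p' $ z}"
  define m where "m = (\<chi> z. min (p $ z) (p' $ z))"
  have m: "m \<in> box_E L U"
    using p p' by (auto simp: box_E_def m_def min_def)
  \<comment> \<open>Each half of incomparability gives one claim: a coordinate with \<open>p\<close>
    below \<open>p'\<close> lies in \<open>A\<close>, and one with \<open>p\<close> above
    \<open>p'\<close> separates \<open>p\<close> from \<open>m\<close>.\<close>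
  have A: "A \<noteq> {}" "p \<noteq> m"
    using neg by (auto simp: A_def m_def less_eq_vec_def vec_eq_iff min_def not_le)
      (metis less_imp_le not_le)+
  have "(\<Sum>x\<in>A. Q p $ x) < (\<Sum>x\<in>A. Q m $ x)"
    using css m p A unfolding connected_strict_substitutes_def
    by (auto simp: A_def m_def min_def)
  moreover have "(\<Sum>x\<in>-A. Q p' $ x) \<le> (\<Sum>x\<in>-A. Q m $ x)"
    by (rule css_sum_antimono[OF css m p']) (auto simp: A_def m_def less_eq_vec_def)
  moreover have "Q p \<in> hyperplane_Lambda c" "Q m \<in> hyperplane_Lambda c"
    using Q p m by auto
  note this[THEN sum_add_sum_Compl, of A]
  ultimately show False using eq by simp
qed

text \<open>For comparable points, a shared coordinate \<open>z\<close> would make \<open>Q\<close>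
  differ at \<open>z\<close>, by connected strict substitutes for \<open>{z}\<close>.\<close>

lemma css_less_or_less:
  fixes Q :: "real ^ 'z::finite \<Rightarrow> real ^ 'z"
  assumes css: "connected_strict_substitutes L U Q" and Q: "Q \<in> box_E L U \<rightarrow> hyperplane_Lambda c"
    and p: "p \<in> box_E L U" and p': "p' \<in> box_E L U" and eq: "Q p = Q p'" and "p \<noteq> p'"
  shows "(\<forall>z. p $ z < p' $ z) \<or> (\<forall>z. p' $ z < p $ z)"
proof -
  have strict: "a $ z < b $ z"
    if "a \<in> box_E L U" "b \<in> box_E L U" "Q a = Q b" "a \<noteq> b" "a \<le> b" for a b z
  proof (rule ccontr)
    assume "\<not> a $ z < b $ z"
    with that(5) have "a $ z = b $ z" by (simp add: less_eq_vec_def order.antisym)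
    then have "(\<Sum>x\<in>{z}. Q a $ x) > (\<Sum>x\<in>{z}. Q b $ x)"
      using css that unfolding connected_strict_substitutes_def less_eq_vec_def by blast
    then show False using that by simp
  qed
  show ?thesis
    using css_le_or_le[OF css Q p p' eq] strict[of p p'] strict[of p' p] assms(4-) p by auto
qed

section \<open>Pivotal substitutes expressed by thresholds\<close>

text \<open>This is the form of the hypothesis \<open>pivot\<close> of \<open>pivotal_sup\<close>,
  with the sum over \<open>X\<close> as \<open>F\<close>.\<close>

lemma downward_pivotal_thresholds:
  assumes "\<And>z. L z < U z" "downward_pivotal_substitutes L U Q q" "X \<noteq> {}" "X \<noteq> UNIV"
    and "p \<in> box_E L U"
  shows "\<exists>t. (\<forall>z. t z < U z) \<and> (\<forall>p'\<in>box_E L U. (\<forall>z\<in>X. p' $ z = p $ z) \<longrightarrow>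
    (\<forall>z\<in>-X. t z < ereal (p' $ z)) \<longrightarrow> (\<Sum>x\<in>X. Q p' $ x) < (\<Sum>x\<in>X. q $ x))"
proof -
  have "eventually (\<lambda>p'. (\<Sum>x\<in>X. Q p' $ x) < (\<Sum>x\<in>X. q $ x))
      (inf (to_upper U (- X)) (principal (fixed_on X p)))"
    using assms unfolding downward_pivotal_substitutes_def by blast
  from eventually_to_upperE[OF assms(1) this] obtain t where "\<And>z. t z < U z"
    "\<And>p'. p' \<in> fixed_on X p \<Longrightarrow> (\<And>z. z \<in> - X \<Longrightarrow> t z < ereal (p' $ z) \<and> ereal (p' $ z) < U z) \<Longrightarrow>
      (\<Sum>x\<in>X. Q p' $ x) < (\<Sum>x\<in>X. q $ x)"
    by blast
  then show ?thesis
    by (intro exI[of _ t]) (auto simp: fixed_on_def box_E_def)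
qed

lemma upward_pivotal_thresholds:
  assumes "\<And>z. L z < U z" "upward_pivotal_substitutes L U Q q" "X \<noteq> {}" "X \<noteq> UNIV"
    and "p \<in> box_E L U"
  shows "\<exists>t. (\<forall>z. L z < t z) \<and> (\<forall>p'\<in>box_E L U. (\<forall>z\<in>X. p' $ z = p $ z) \<longrightarrow>
    (\<forall>z\<in>-X. ereal (p' $ z) < t z) \<longrightarrow> (\<Sum>x\<in>X. q $ x) < (\<Sum>x\<in>X. Q p' $ x))"
proof -
  have "eventually (\<lambda>p'. (\<Sum>x\<in>X. Q p' $ x) > (\<Sum>x\<in>X. q $ x))
      (inf (to_lower L (- X)) (principal (fixed_on X p)))"
    using assms unfolding upward_pivotal_substitutes_def by blast
  from eventually_to_lowerE[OF assms(1) this] obtain t where "\<And>z. L z < t z"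
    "\<And>p'. p' \<in> fixed_on X p \<Longrightarrow> (\<And>z. z \<in> - X \<Longrightarrow> L z < ereal (p' $ z) \<and> ereal (p' $ z) < t z) \<Longrightarrow>
      (\<Sum>x\<in>X. q $ x) < (\<Sum>x\<in>X. Q p' $ x)"
    by blast
  then show ?thesis
    by (intro exI[of _ t]) (auto simp: fixed_on_def box_E_def)
qed

section \<open>Solutions with a prescribed coordinate \<open>z0\<close>\<close>

text \<open>Lowering a later coordinate may raise earlier components of \<open>Q\<close>, but it
  leaves the earlier bounds \<open>B j\<close> unchanged. Hence each \<open>B k\<close> can be
  pushed below its target in turn by lowering coordinate \<open>e k\<close>.\<close>

lemma ex_subsolution:
  fixes L U :: "'z::finite \<Rightarrow> ereal" and Q :: "real ^ 'z \<Rightarrow> real ^ 'z" and e :: "nat \<Rightarrow> 'z"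
  assumes bounds: "\<And>z. L z < U z"
    and e: "bij_betw e {1..CARD('z)} UNIV"
    and Qbar: "\<forall>k\<in>{2..CARD('z)}. \<exists>Qbar :: real ^ 'z \<Rightarrow> real.
         (\<forall>p\<in>box_E L U. Q p $ e k \<le> Qbar p) \<and>
         (\<forall>p\<in>box_E L U. \<forall>p'\<in>box_E L U.
            (\<forall>j\<in>{1..k}. p $ e j = p' $ e j) \<longrightarrow> Qbar p = Qbar p') \<and>
         downward_responsive L U Qbar (e k) (q $ e k)"
    and \<pi>: "L (e 1) < ereal \<pi>" "ereal \<pi> < U (e 1)"
  shows "\<exists>p\<in>box_E L U. p $ e 1 = \<pi> \<and> (\<forall>z. z \<noteq> e 1 \<longrightarrow> Q p $ z \<le> q $ z)"
proof -
  from Qbar obtain B :: "nat \<Rightarrow> real ^ 'z \<Rightarrow> real" where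
    le: "\<And>k p. k \<in> {2..CARD('z)} \<Longrightarrow> p \<in> box_E L U \<Longrightarrow> Q p $ e k \<le> B k p"
    and dep: "\<And>k p p'. k \<in> {2..CARD('z)} \<Longrightarrow> p \<in> box_E L U \<Longrightarrow> p' \<in> box_E L U \<Longrightarrow>
      (\<forall>j\<in>{1..k}. p $ e j = p' $ e j) \<Longrightarrow> B k p = B k p'"
    and resp: "\<And>k. k \<in> {2..CARD('z)} \<Longrightarrow> downward_responsive L U (B k) (e k) (q $ e k)"
    by metis
  \<comment> \<open>After stage \<open>m\<close> the coordinates up to \<open>e (Suc m)\<close> are
    settled. At \<open>m = 0\<close> the range of \<open>k\<close> is empty, and
    \<open>m = CARD('z) - 1\<close> covers all coordinates.\<close>
  have "m < CARD('z) \<Longrightarrow> \<exists>p\<in>box_E L U. p $ e 1 = \<pi> \<and> (\<forall>k\<in>{2..Suc m}. B k p < q $ e k)" for m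
  proof (induction m)
    case 0
    obtain p where p: "p \<in> box_E L U"
      using box_E_nonempty[of L U] bounds by blast
    then show ?case
      using \<pi> by (intro bexI[of _ "\<chi> z. if z = e 1 then \<pi> else p $ z"]) (auto simp: box_E_def)
  next
    case (Suc m)
    then obtain p where p: "p \<in> box_E L U" "p $ e 1 = \<pi>" "\<And>k. k \<in> {2..Suc m} \<Longrightarrow> B k p < q $ e k"
      by auto
    let ?k = "Suc (Suc m)"
    have k: "?k \<in> {2..CARD('z)}" using Suc by auto
    from resp[OF k] p(1) obtain l where l: "l < ereal (q $ e ?k)"
      "((\<lambda>p'. ereal (B ?k p')) \<longlongrightarrow> l)
        (inf (to_lower L {e ?k}) (principal (fixed_on (- {e ?k}) p)))"
      unfolding downward_responsive_def by blast
    from order_tendstoD(2)[OF l(2,1)]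
    have "eventually (\<lambda>p'. B ?k p' < q $ e ?k)
        (inf (to_lower L {e ?k}) (principal (fixed_on (- {e ?k}) p)))"
      by simp
    from eventually_to_lowerE[OF bounds this] obtain t where t: "\<And>z. L z < t z"
      "\<And>p'. p' \<in> fixed_on (- {e ?k}) p \<Longrightarrow> L (e ?k) < ereal (p' $ e ?k) \<Longrightarrow>
        ereal (p' $ e ?k) < t (e ?k) \<Longrightarrow> B ?k p' < q $ e ?k"
      by (metis singletonD)
    obtain r where r: "L (e ?k) < ereal r" "ereal r < min (t (e ?k)) (U (e ?k))"
      using ereal_dense2[of "L (e ?k)" "min (t (e ?k)) (U (e ?k))"] t(1) bounds by auto
    define p' where "p' = (\<chi> z. if z = e ?k then r else p $ z)"
    have p': "p' \<in> box_E L U"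
      using p(1) r by (auto simp: box_E_def p'_def)
    have neq: "e j \<noteq> e ?k" if "j \<in> {1..Suc m}" for j
    proof -
      have "j \<in> {1..CARD('z)}" "?k \<in> {1..CARD('z)}" "j \<noteq> ?k" using that k by simp_all
      then show ?thesis using inj_onD[OF bij_betw_imp_inj_on[OF e], of j ?k] by blast
    qed
    have "B j p' < q $ e j" if "j \<in> {2..Suc ?k}" "j \<le> ?k" for j
    proof (cases "j = ?k")
      case True
      then show ?thesis using t(2)[of p'] r by (auto simp: p'_def fixed_on_def)
    next
      case False
      then have j: "j \<in> {2..Suc m}" using that by auto
      have "B j p' = B j p"
      proof (rule dep)
        show "\<forall>i\<in>{1..j}. p' $ e i = p $ e i" using neq j by (auto simp: p'_def)
      qed (use j k p p' in auto)
      then show ?thesis using p(3)[OF j] by simp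
    qed
    moreover have "p' $ e 1 = \<pi>" using neq[of 1] p(2) by (simp add: p'_def)
    ultimately show ?case using p' by (intro bexI[of _ p']) auto
  qed
  from this[of "CARD('z) - 1"] obtain p where p: "p \<in> box_E L U" "p $ e 1 = \<pi>"
    "\<And>k. k \<in> {2..CARD('z)} \<Longrightarrow> B k p < q $ e k"
    by auto
  have "Q p $ z \<le> q $ z" if "z \<noteq> e 1" for z
  proof -
    obtain k where "z = e k" "k \<in> {1..CARD('z)}"
      using e by (metis UNIV_I bij_betw_iff_bijections)
    moreover from this have "k \<in> {2..CARD('z)}"
      using that by (cases "k = 1") auto
    ultimately show ?thesis
      using le[of k p] p(1) p(3)[of k] by simp
  qed
  then show ?thesis using p by auto
qed

text \<open>The largest subsolution is a solution. The bound on \<open>Q\<close> is imposed only off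
  \<open>z0\<close>; the remaining equation follows from the common total \<open>c\<close>.\<close>

lemma ex_solution_of_subsolution:
  fixes L U :: "'z::finite \<Rightarrow> ereal" and Q :: "real ^ 'z \<Rightarrow> real ^ 'z"
  assumes bounds: "\<And>z. L z < U z" and q: "q \<in> hyperplane_Lambda c"
    and Q: "Q \<in> box_E L U \<rightarrow> hyperplane_Lambda c" and cont: "continuous_on (box_E L U) Q"
    and css: "connected_strict_substitutes L U Q" and piv: "downward_pivotal_substitutes L U Q q"
    and p0: "p0 \<in> box_E L U" "\<And>z. z \<noteq> z0 \<Longrightarrow> Q p0 $ z \<le> q $ z"
  shows "\<exists>p\<in>box_E L U. Q p = q \<and> p $ z0 = p0 $ z0"
proof -
  define S where "S = {p \<in> box_E L U. p $ z0 = p0 $ z0 \<and> (\<forall>z. z \<noteq> z0 \<longrightarrow> Q p $ z \<le> q $ z)}"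
  have "p0 \<in> S" using p0 by (simp add: S_def)
  have anti: "Q p' $ z \<le> Q p $ z"
    if "p \<in> box_E L U" "p' \<in> box_E L U" "p \<le> p'" "p $ z = p' $ z" for p p' z
    using css_sum_antimono[OF css that(1-3), of "{z}"] that(4) by simp
  \<comment> \<open>In each coordinate the join agrees with one of the two points and lies above it,
    so \<open>anti\<close> applies to that point.\<close>
  have join: "sup p p' \<in> S" if "p \<in> S" "p' \<in> S" for p p'
  proof -
    have E: "p \<in> box_E L U" "p' \<in> box_E L U" "sup p p' \<in> box_E L U"
      using that sup_in_box_E by (auto simp: S_def)
    have "Q (sup p p') $ z \<le> q $ z" if "z \<noteq> z0" for z
    proof (cases "p' $ z \<le> p $ z")
      case True
      then have "Q (sup p p') $ z \<le> Q p $ z"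
        by (intro anti E sup_ge1 sup_ge2) (auto simp: sup_vec_def sup_real_def)
      also have "\<dots> \<le> q $ z" using \<open>p \<in> S\<close> that by (simp add: S_def)
      finally show ?thesis .
    next
      case False
      then have "Q (sup p p') $ z \<le> Q p' $ z"
        by (intro anti E sup_ge1 sup_ge2) (auto simp: sup_vec_def sup_real_def)
      also have "\<dots> \<le> q $ z" using \<open>p' \<in> S\<close> that by (simp add: S_def)
      finally show ?thesis .
    qed
    with E that show ?thesis by (simp add: S_def sup_vec_def)
  qed
  have SE: "S \<subseteq> box_E L U" "S \<noteq> {}" using \<open>p0 \<in> S\<close> by (auto simp: S_def)
  define X where "X = {z. (SUP p\<in>S. ereal (p $ z)) < U z}"
  \<comment> \<open>The coordinate \<open>z0\<close> is constant on \<open>S\<close>. This makes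
    \<open>X\<close> nonempty, as pivotal substitutes require.\<close>
  have "(SUP p\<in>S. ereal (p $ z0)) = (SUP p\<in>S. ereal (p0 $ z0))"
    by (rule SUP_cong) (auto simp: S_def)
  then have "z0 \<in> X"
    using SE p0(1) by (simp add: X_def box_E_def)
  \<comment> \<open>Otherwise some member of \<open>S\<close> has a sum over \<open>X\<close>
    strictly below that of \<open>q\<close>. Since \<open>z0\<close> lies in \<open>X\<close>, its
    sum over \<open>- X\<close> is at most that of \<open>q\<close>, so the totals could not both be
    \<open>c\<close>.\<close>
  have "X = UNIV"
  proof (rule ccontr)
    assume X: "X \<noteq> UNIV"
    have "\<exists>p\<in>S. (\<Sum>x\<in>X. Q p $ x) < (\<Sum>x\<in>X. q $ x)"
      using \<open>z0 \<in> X\<close> X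
      by (intro pivotal_sup[OF SE join X_def] css_sum_mono[OF css Q]
          downward_pivotal_thresholds[OF bounds piv]) auto
    then obtain p where p: "p \<in> S" "(\<Sum>x\<in>X. Q p $ x) < (\<Sum>x\<in>X. q $ x)" by auto
    have "(\<Sum>x\<in>-X. Q p $ x) \<le> (\<Sum>x\<in>-X. q $ x)"
      using p(1) \<open>z0 \<in> X\<close> by (intro sum_mono) (auto simp: S_def)
    moreover have "Q p \<in> hyperplane_Lambda c" using p(1) SE Q by auto
    ultimately show False
      using p(2) q sum_add_sum_Compl[of "Q p" c X] sum_add_sum_Compl[of q c X] by simp
  qed
  define s :: "real ^ 'z" where "s = (\<chi> z. real_of_ereal (SUP p\<in>S. ereal (p $ z)))"
  have s: "ereal (s $ z) = (SUP p\<in>S. ereal (p $ z))" for z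
  proof -
    have "ereal (p0 $ z) \<le> (SUP p\<in>S. ereal (p $ z))" "(SUP p\<in>S. ereal (p $ z)) < U z"
      using \<open>X = UNIV\<close> \<open>p0 \<in> S\<close> by (auto simp: X_def intro: SUP_upper)
    then show ?thesis by (cases "SUP p\<in>S. ereal (p $ z)") (auto simp: s_def)
  qed
  have upper: "p \<le> s" if "p \<in> S" for p
    using that s by (auto simp: less_eq_vec_def simp flip: ereal_less_eq(3) intro!: SUP_upper)
  have sE: "s \<in> box_E L U"
  proof -
    have "ereal (p0 $ z) \<le> ereal (s $ z)" "L z < ereal (p0 $ z)" for z
      using upper[OF \<open>p0 \<in> S\<close>] p0(1) by (auto simp: less_eq_vec_def box_E_def)
    moreover have "ereal (s $ z) < U z" for z
      using \<open>X = UNIV\<close> s by (auto simp: X_def)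
    ultimately show ?thesis unfolding box_E_def by (blast intro: less_le_trans)
  qed
  \<comment> \<open>Closure under joins provides single members close to the supremum in all
    coordinates at once, hence a sequence in \<open>S\<close> converging to
    \<open>s\<close>.\<close>
  have "\<exists>p\<in>S. \<forall>z\<in>UNIV. ereal (s $ z - inverse (Suc n)) < ereal (p $ z)" for n
  proof (rule ex_common_upper[OF SE(2) join])
    show "\<exists>p\<in>S. ereal (s $ z - inverse (Suc n)) < ereal (p $ z)" for z
      unfolding less_SUP_iff[symmetric] s[symmetric] by simp
  qed
  then obtain P where P: "\<And>n. P n \<in> S" "\<And>n z. s $ z - inverse (Suc n) < P n $ z"
    by (metis UNIV_I less_ereal.simps(1))
  have lim: "P \<longlonglongrightarrow> s"
  proof (rule vec_tendstoI)
    fix z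
    have "(\<lambda>n. s $ z - inverse (Suc n)) \<longlonglongrightarrow> s $ z - 0"
      by (intro tendsto_intros LIMSEQ_inverse_real_of_nat)
    moreover have "\<forall>n. s $ z - inverse (Suc n) \<le> P n $ z" "\<forall>n. P n $ z \<le> s $ z"
      using P upper by (auto simp: less_eq_vec_def less_imp_le)
    ultimately show "(\<lambda>n. P n $ z) \<longlonglongrightarrow> s $ z"
      by (simp add: real_tendsto_sandwich[OF always_eventually always_eventually _ tendsto_const])
  qed
  have "s $ z0 = p0 $ z0"
  proof (rule LIMSEQ_unique)
    show "(\<lambda>n. P n $ z0) \<longlonglongrightarrow> s $ z0" using lim by (rule tendsto_vec_nth)
    show "(\<lambda>n. P n $ z0) \<longlonglongrightarrow> p0 $ z0" using P(1) by (simp add: S_def)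
  qed
  have le: "Q s $ z \<le> q $ z" if "z \<noteq> z0" for z
  proof (rule LIMSEQ_le_const2)
    show "(\<lambda>n. Q (P n) $ z) \<longlonglongrightarrow> Q s $ z"
      using P(1) by (intro tendsto_vec_nth continuous_on_tendsto_compose[OF cont lim sE]
          always_eventually) (simp add: S_def)
    show "\<exists>N. \<forall>n\<ge>N. Q (P n) $ z \<le> q $ z" using P(1) that by (simp add: S_def)
  qed
  \<comment> \<open>With a strict inequality, coordinate \<open>z\<close> could be raised a little:
    continuity preserves the inequality at \<open>z\<close>, and the other components of
    \<open>Q\<close> do not rise. The new point would lie in \<open>S\<close> but not below
    \<open>s\<close>.\<close>
  have eq: "Q s $ z = q $ z" if z: "z \<noteq> z0" for z
  proof (rule ccontr)
    assume "Q s $ z \<noteq> q $ z"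
    with le[OF z] have less: "Q s $ z < q $ z" by simp
    define g where "g h = s + h *\<^sub>R axis z 1" for h :: real
    have "((\<lambda>h. s + h *\<^sub>R axis z 1) \<longlongrightarrow> s + 0 *\<^sub>R axis z 1) (at_right 0)"
      by (intro tendsto_intros)
    then have g: "(g \<longlongrightarrow> s) (at_right 0)" by (simp add: g_def[abs_def])
    then have gE: "eventually (\<lambda>h. g h \<in> box_E L U) (at_right 0)"
      using open_box_E sE by (rule topological_tendstoD)
    have "((\<lambda>h. Q (g h) $ z) \<longlongrightarrow> Q s $ z) (at_right 0)"
      by (intro tendsto_vec_nth continuous_on_tendsto_compose[OF cont g sE] gE)
    from order_tendstoD(2)[OF this less] gE eventually_at_right_less[of 0]
    have "eventually (\<lambda>h. Q (g h) $ z < q $ z \<and> g h \<in> box_E L U \<and> 0 < h) (at_right 0)"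
      by eventually_elim simp
    then obtain h where h: "Q (g h) $ z < q $ z" "g h \<in> box_E L U" "0 < h"
      using eventually_happens trivial_limit_at_right_real by blast
    have gs: "s \<le> g h" "\<And>y. y \<noteq> z \<Longrightarrow> g h $ y = s $ y" "s $ z < g h $ z"
      using h(3) by (auto simp: g_def less_eq_vec_def axis_def)
    have "Q (g h) $ y \<le> q $ y" if "y \<noteq> z0" for y
    proof (cases "y = z")
      case False
      then have "Q (g h) $ y \<le> Q s $ y"
        using gs by (intro anti sE h) auto
      then show ?thesis using le[OF that] by simp
    qed (use h in simp)
    then have "g h \<in> S"
      using h gs(2)[of z0] z \<open>s $ z0 = p0 $ z0\<close> by (auto simp: S_def)
    then have "g h \<le> s" by (rule upper)
    then show False using gs(3) by (simp add: less_eq_vec_def not_le[symmetric])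
  qed
  have "Q s \<in> hyperplane_Lambda c" using sE Q by auto
  then have "Q s $ z0 = q $ z0"
    using q eq sum.cong[of "- {z0}" "- {z0}" "($) (Q s)" "($) q"]
      sum_add_sum_Compl[of "Q s" c "{z0}"] sum_add_sum_Compl[of q c "{z0}"] by simp
  with eq have "Q s = q" by (metis vec_eq_iff)
  then show ?thesis using sE \<open>s $ z0 = p0 $ z0\<close> by auto
qed

section \<open>Solutions near the bounds and connectedness of the solution curve\<close>

text \<open>The solutions form a chain, so they are closed under joins. A coordinate whose supremum
  stays below its bound would, by pivotal substitutes, yield a solution whose sum over
  \<open>X\<close> differs from that of \<open>q\<close>.\<close>

lemma ex_solution_above:
  fixes L U :: "'z::finite \<Rightarrow> ereal" and Q :: "real ^ 'z \<Rightarrow> real ^ 'z"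
  assumes bounds: "\<And>z. L z < U z" and Q: "Q \<in> box_E L U \<rightarrow> hyperplane_Lambda c"
    and css: "connected_strict_substitutes L U Q" and piv: "downward_pivotal_substitutes L U Q q"
    and ex: "\<And>\<pi>. L z0 < ereal \<pi> \<Longrightarrow> ereal \<pi> < U z0 \<Longrightarrow> \<exists>p\<in>box_E L U. Q p = q \<and> p $ z0 = \<pi>"
    and t: "\<And>z. t z < U z"
  shows "\<exists>p\<in>box_E L U. Q p = q \<and> (\<forall>z. t z < ereal (p $ z))"
proof -
  define M where "M = {p \<in> box_E L U. Q p = q}"
  have join: "sup p p' \<in> M" if "p \<in> M" "p' \<in> M" for p p'
    using that css_le_or_le[OF css Q, of p p'] by (auto simp: M_def sup.absorb1 sup.absorb2)
  obtain \<pi> where "L z0 < ereal \<pi>" "ereal \<pi> < U z0" using ereal_dense2[OF bounds] by blast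
  with ex obtain p0 where p0: "p0 \<in> M" by (auto simp: M_def)
  then have M: "M \<subseteq> box_E L U" "M \<noteq> {}" by (auto simp: M_def)
  define X where "X = {z. (SUP p\<in>M. ereal (p $ z)) < U z}"
  \<comment> \<open>Any value \<open>r\<close> between the supremum and \<open>U z0\<close> is
    itself the \<open>z0\<close>-coordinate of a solution. So \<open>X\<close> is proper, as pivotal
    substitutes require.\<close>
  have "z0 \<notin> X"
  proof
    assume "z0 \<in> X"
    then obtain r where r: "(SUP p\<in>M. ereal (p $ z0)) < ereal r" "ereal r < U z0"
      using ereal_dense2 by (auto simp: X_def)
    have "L z0 < ereal (p0 $ z0)" "ereal (p0 $ z0) \<le> (SUP p\<in>M. ereal (p $ z0))"
      using p0 M by (auto simp: box_E_def intro: SUP_upper)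
    with r have "L z0 < ereal r" by order
    with r ex[of r] obtain p where "p \<in> M" "p $ z0 = r" by (auto simp: M_def)
    then have "ereal r \<le> (SUP p\<in>M. ereal (p $ z0))" by (auto intro: SUP_upper2)
    with r show False by simp
  qed
  have "X = {}"
  proof (rule ccontr)
    assume "X \<noteq> {}"
    then have "\<exists>p\<in>M. (\<Sum>x\<in>X. Q p $ x) < (\<Sum>x\<in>X. q $ x)"
      using \<open>z0 \<notin> X\<close>
      by (intro pivotal_sup[OF M join X_def] css_sum_mono[OF css Q]
          downward_pivotal_thresholds[OF bounds piv]) auto
    then show False by (auto simp: M_def)
  qed
  have "\<exists>p\<in>M. t z < ereal (p $ z)" for z
    unfolding less_SUP_iff[symmetric] using t[of z] \<open>X = {}\<close> by (auto simp: X_def not_less intro: less_le_trans)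
  then have "\<exists>p\<in>M. \<forall>z\<in>UNIV. t z < ereal (p $ z)"
    by (intro ex_common_upper M join)
  then show ?thesis by (auto simp: M_def)
qed

text \<open>The dual argument uses meets, infima and upward pivotal substitutes.\<close>

lemma ex_solution_below:
  fixes L U :: "'z::finite \<Rightarrow> ereal" and Q :: "real ^ 'z \<Rightarrow> real ^ 'z"
  assumes bounds: "\<And>z. L z < U z" and Q: "Q \<in> box_E L U \<rightarrow> hyperplane_Lambda c"
    and css: "connected_strict_substitutes L U Q" and piv: "upward_pivotal_substitutes L U Q q"
    and ex: "\<And>\<pi>. L z0 < ereal \<pi> \<Longrightarrow> ereal \<pi> < U z0 \<Longrightarrow> \<exists>p\<in>box_E L U. Q p = q \<and> p $ z0 = \<pi>"
    and t: "\<And>z. L z < t z"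
  shows "\<exists>p\<in>box_E L U. Q p = q \<and> (\<forall>z. ereal (p $ z) < t z)"
proof -
  define M where "M = {p \<in> box_E L U. Q p = q}"
  have meet: "inf p p' \<in> M" if "p \<in> M" "p' \<in> M" for p p'
    using that css_le_or_le[OF css Q, of p p'] by (auto simp: M_def inf.absorb1 inf.absorb2)
  obtain \<pi> where "L z0 < ereal \<pi>" "ereal \<pi> < U z0" using ereal_dense2[OF bounds] by blast
  with ex obtain p0 where p0: "p0 \<in> M" by (auto simp: M_def)
  then have M: "M \<subseteq> box_E L U" "M \<noteq> {}" by (auto simp: M_def)
  define X where "X = {z. L z < (INF p\<in>M. ereal (p $ z))}"
  have "z0 \<notin> X"
  proof
    assume "z0 \<in> X"
    then obtain r where r: "L z0 < ereal r" "ereal r < (INF p\<in>M. ereal (p $ z0))"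
      using ereal_dense2 by (auto simp: X_def)
    have "ereal (p0 $ z0) < U z0" "(INF p\<in>M. ereal (p $ z0)) \<le> ereal (p0 $ z0)"
      using p0 M by (auto simp: box_E_def intro: INF_lower)
    with r have "ereal r < U z0" by order
    with r ex[of r] obtain p where "p \<in> M" "p $ z0 = r" by (auto simp: M_def)
    then have "(INF p\<in>M. ereal (p $ z0)) \<le> ereal r" by (auto intro: INF_lower2)
    with r show False by simp
  qed
  have "X = {}"
  proof (rule ccontr)
    assume "X \<noteq> {}"
    then have "\<exists>p\<in>M. (\<Sum>x\<in>X. q $ x) < (\<Sum>x\<in>X. Q p $ x)"
      using \<open>z0 \<notin> X\<close>
      by (intro pivotal_inf[OF M meet X_def] css_sum_mono[OF css Q]
          upward_pivotal_thresholds[OF bounds piv]) auto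
    then show False by (auto simp: M_def)
  qed
  have "\<exists>p\<in>M. ereal (p $ z) < t z" for z
    unfolding INF_less_iff[symmetric] using t[of z] \<open>X = {}\<close> by (auto simp: X_def not_less intro: le_less_trans)
  then have "\<exists>p\<in>M. \<forall>z\<in>UNIV. ereal (p $ z) < t z"
    by (intro ex_common_lower M meet)
  then show ?thesis by (auto simp: M_def)
qed

text \<open>
  Being compact, the set is homeomorphic to its projection to the coordinate \<open>z0\<close>, an interval.
\<close>
lemma connected_solutions_between:
  fixes L U :: "'z::finite \<Rightarrow> ereal" and Q :: "real ^ 'z \<Rightarrow> real ^ 'z"
  assumes Q: "Q \<in> box_E L U \<rightarrow> hyperplane_Lambda c" and cont: "continuous_on (box_E L U) Q"
    and css: "connected_strict_substitutes L U Q"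
    and ex: "\<And>\<pi>. L z0 < ereal \<pi> \<Longrightarrow> ereal \<pi> < U z0 \<Longrightarrow> \<exists>p\<in>box_E L U. Q p = q \<and> p $ z0 = \<pi>"
    and a: "a \<in> box_E L U" "Q a = q" and b: "b \<in> box_E L U" "Q b = q"
  shows "connected ({a..b} \<inter> {p. Q p = q})"
proof -
  let ?C = "{a..b} \<inter> {p. Q p = q}"
  have E: "{a..b} \<subseteq> box_E L U"
    using box_E_order_convex[OF a(1) b(1)] by auto
  have "closed ({a..b} \<inter> Q -` {q})"
    using E by (intro continuous_closed_preimage continuous_on_subset[OF cont]) auto
  then have "compact ({a..b} \<inter> ({a..b} \<inter> Q -` {q}))"
    by (intro compact_Int_closed) (simp_all add: interval_cbox_cart)
  moreover have "{a..b} \<inter> ({a..b} \<inter> Q -` {q}) = ?C" by auto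
  ultimately have compact: "compact ?C" by simp
  \<comment> \<open>Distinct solutions are strictly ordered in all coordinates, so \<open>z0\<close>
    alone decides their order. This gives injectivity of the projection and puts the solutions found
    by \<open>ex\<close> between \<open>a\<close> and \<open>b\<close>.\<close>
  have order: "p \<le> p'" if "p \<in> box_E L U" "Q p = q" "p' \<in> box_E L U" "Q p' = q" "p $ z0 \<le> p' $ z0" for p p'
    using css_less_or_less[OF css Q that(1,3)] that
    by (cases "p = p'") (auto simp: less_eq_vec_def less_imp_le not_le[symmetric])
  have inj: "inj_on (\<lambda>p. p $ z0) ?C"
  proof (rule inj_onI)
    fix p p' assume "p \<in> ?C" "p' \<in> ?C" "p $ z0 = p' $ z0"
    then have "p \<le> p'" "p' \<le> p" using E by (auto intro!: order)
    then show "p = p'" by (rule order.antisym)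
  qed
  have img: "(\<lambda>p. p $ z0) ` ?C = {a $ z0..b $ z0}"
  proof (intro equalityI subsetI)
    fix \<pi> assume \<pi>: "\<pi> \<in> {a $ z0..b $ z0}"
    then have "ereal (a $ z0) \<le> ereal \<pi>" "ereal \<pi> \<le> ereal (b $ z0)" by simp_all
    moreover have "L z0 < ereal (a $ z0)" "ereal (b $ z0) < U z0"
      using a(1) b(1) by (simp_all add: box_E_def)
    ultimately have "L z0 < ereal \<pi>" "ereal \<pi> < U z0" by order+
    then obtain p where p: "p \<in> box_E L U" "Q p = q" "p $ z0 = \<pi>" using ex by blast
    then have "p \<in> ?C" using order[of a p] order[of p b] a b \<pi> by auto
    then show "\<pi> \<in> (\<lambda>p. p $ z0) ` ?C" using p by auto
  qed (auto simp: less_eq_vec_def)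
  define g where "g = the_inv_into ?C (\<lambda>p. p $ z0)"
  have g: "g (p $ z0) = p" if "p \<in> ?C" for p
    unfolding g_def using inj that by (rule the_inv_into_f_f)
  \<comment> \<open>A continuous injection on a compact set has a continuous inverse.\<close>
  then have "continuous_on ((\<lambda>p. p $ z0) ` ?C) g"
    by (intro continuous_on_inv compact continuous_intros) blast
  then have "connected (g ` (\<lambda>p. p $ z0) ` ?C)"
    by (rule connected_continuous_image) (simp add: img)
  also have "g ` (\<lambda>p. p $ z0) ` ?C = ?C"
    using g by (force simp: image_image)
  finally show ?thesis .
qed

section \<open>Intersection of the solution curve with a level set of \<psi>\<close>

theorem corollary2:
  fixes z0 :: "'z::finite"
    and L U :: "'z \<Rightarrow> ereal"
    and c :: real
    and q :: "real ^ 'z"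
    and Q :: "real ^ 'z \<Rightarrow> real ^ 'z"
    and \<psi> :: "real ^ 'z \<Rightarrow> real"
    and L\<psi> U\<psi> :: ereal
    and K :: real
  assumes bounds: "\<And>z. L z < U z"
    and q_in: "q \<in> hyperplane_Lambda c"
    and Q_maps: "Q \<in> box_E L U \<rightarrow> hyperplane_Lambda c"
    and Q_cont: "continuous_on (box_E L U) Q"
    and weak: "weak_substitutes L U Q"
    and pivotal: "pivotal_substitutes L U Q q"
    and resp: "\<And>x. responsive L U (\<lambda>p. Q p $ x) x (q $ x)"
    and order: "\<exists>e :: nat \<Rightarrow> 'z. bij_betw e {1..CARD('z)} UNIV \<and> e 1 = z0 \<and>
      (\<forall>k\<in>{2..CARD('z)}. \<exists>Qbar :: real ^ 'z \<Rightarrow> real.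
         (\<forall>p\<in>box_E L U. Q p $ e k \<le> Qbar p) \<and>
         (\<forall>p\<in>box_E L U. \<forall>p'\<in>box_E L U.
            (\<forall>j\<in>{1..k}. p $ e j = p' $ e j) \<longrightarrow> Qbar p = Qbar p') \<and>
         downward_responsive L U Qbar (e k) (q $ e k))"
    and css: "connected_strict_substitutes L U Q"
    and norm: "normalization_mapping L U L\<psi> U\<psi> \<psi>"
    and norm_strict: "\<And>p p'. (\<And>z. p $ z < p' $ z) \<Longrightarrow> \<psi> p < \<psi> p'"
    and K: "L\<psi> < ereal K" "ereal K < U\<psi>"
  shows "\<exists>!p. p \<in> box_E L U \<and> Q p = q \<and> \<psi> p = K"
proof (rule ex_ex1I)
  have down: "downward_pivotal_substitutes L U Q q" and up: "upward_pivotal_substitutes L U Q q"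
    using pivotal by (auto simp: pivotal_substitutes_def)
  obtain e :: "nat \<Rightarrow> 'z" where e: "bij_betw e {1..CARD('z)} UNIV" "e 1 = z0"
    and Qbar: "\<forall>k\<in>{2..CARD('z)}. \<exists>Qbar :: real ^ 'z \<Rightarrow> real.
         (\<forall>p\<in>box_E L U. Q p $ e k \<le> Qbar p) \<and>
         (\<forall>p\<in>box_E L U. \<forall>p'\<in>box_E L U.
            (\<forall>j\<in>{1..k}. p $ e j = p' $ e j) \<longrightarrow> Qbar p = Qbar p') \<and>
         downward_responsive L U Qbar (e k) (q $ e k)"
    using order by blast
  have ex: "\<exists>p\<in>box_E L U. Q p = q \<and> p $ z0 = \<pi>" if \<pi>: "L z0 < ereal \<pi>" "ereal \<pi> < U z0" for \<pi>
  proof -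
    obtain p where "p \<in> box_E L U" "p $ z0 = \<pi>" "\<And>z. z \<noteq> z0 \<Longrightarrow> Q p $ z \<le> q $ z"
      using ex_subsolution[OF bounds e(1) Qbar] \<pi> unfolding e(2) by blast
    then show ?thesis
      using ex_solution_of_subsolution[OF bounds q_in Q_maps Q_cont css down, of p z0] by blast
  qed
  have \<psi>_cont: "continuous_on UNIV \<psi>"
    \<comment> \<open>The trivial infimum with \<open>principal UNIV\<close> matches the form of the
      threshold lemmas.\<close>
    and \<psi>L: "((\<lambda>p. ereal (\<psi> p)) \<longlongrightarrow> L\<psi>) (inf (to_lower L UNIV) (principal UNIV))"
    and \<psi>U: "((\<lambda>p. ereal (\<psi> p)) \<longlongrightarrow> U\<psi>) (inf (to_upper U UNIV) (principal UNIV))"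
    using norm by (simp_all add: normalization_mapping_def)
  obtain t where t: "\<And>z. L z < t z"
    "\<And>p. (\<And>z. L z < ereal (p $ z) \<and> ereal (p $ z) < t z) \<Longrightarrow> \<psi> p < K"
    by (rule eventually_to_lowerE[OF bounds order_tendstoD(2)[OF \<psi>L K(1)]]) auto
  obtain a where a: "a \<in> box_E L U" "Q a = q" "\<And>z. ereal (a $ z) < t z"
    using ex_solution_below[OF bounds Q_maps css up ex t(1)] by blast
  have aK: "\<psi> a < K" using a by (intro t(2)) (auto simp: box_E_def)
  obtain u where u: "\<And>z. u z < U z"
    "\<And>p. (\<And>z. u z < ereal (p $ z) \<and> ereal (p $ z) < U z) \<Longrightarrow> K < \<psi> p"
    by (rule eventually_to_upperE[OF bounds order_tendstoD(1)[OF \<psi>U K(2)]]) auto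
  obtain b where b: "b \<in> box_E L U" "Q b = q" "\<And>z. u z < ereal (b $ z)"
    using ex_solution_above[OF bounds Q_maps css down ex u(1)] by blast
  have bK: "K < \<psi> b" using b by (intro u(2)) (auto simp: box_E_def)
  \<comment> \<open>Solutions are strictly ordered one way or the other, and \<psi> rules out that
    \<open>b\<close> lies below \<open>a\<close>.\<close>
  have "a \<noteq> b" "\<not> (\<forall>z. b $ z < a $ z)"
    using aK bK norm_strict[of b a] by auto
  then have "a \<le> b"
    using css_less_or_less[OF css Q_maps a(1) b(1)] a b by (auto simp: less_eq_vec_def less_imp_le)
  let ?C = "{a..b} \<inter> {p. Q p = q}"
  \<comment> \<open>The intermediate value argument: the image is an interval with values on both
    sides of \<open>K\<close>.\<close>
  have "connected (\<psi> ` ?C)"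
    by (intro connected_continuous_image continuous_on_subset[OF \<psi>_cont]
        connected_solutions_between[OF Q_maps Q_cont css ex a(1,2) b(1,2)]) auto
  moreover have "\<psi> a \<in> \<psi> ` ?C" "\<psi> b \<in> \<psi> ` ?C"
    using \<open>a \<le> b\<close> a b by auto
  ultimately have "K \<in> \<psi> ` ?C"
    using aK bK by (meson connected_iff_interval less_imp_le)
  then obtain p where "\<psi> p = K" "a \<le> p" "p \<le> b" "Q p = q" by auto
  then show "\<exists>p. p \<in> box_E L U \<and> Q p = q \<and> \<psi> p = K"
    using box_E_order_convex[OF a(1) b(1)] by blast
next
  fix p p'
  assume p: "p \<in> box_E L U \<and> Q p = q \<and> \<psi> p = K" "p' \<in> box_E L U \<and> Q p' = q \<and> \<psi> p' = K"
  \<comment> \<open>Two distinct solutions would be strictly ordered in every coordinate, and \<psi>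
    would separate them.\<close>
  then have "\<not> (\<forall>z. p $ z < p' $ z)" "\<not> (\<forall>z. p' $ z < p $ z)"
    using norm_strict[of p p'] norm_strict[of p' p] by auto
  then show "p = p'"
    using css_less_or_less[OF css Q_maps, of p p'] p by auto
qed

end
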